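(* Let $n\geq 1$ be an integer. Then there exists a tournament $T_{2n+3}$ on $2n+3$ vertices such that $\overrightarrow{\mathcal{N}}(T_{2n+3})$ collapses onto the boundary of a simplex of dimension $n+1$. In particular, $\overrightarrow{\mathcal{N}}(T_{2n+3})\simeq\mathbb{S}^n$.
   Context: A digraph $G$ consists of a finite vertex set $V(G)$ and an edge set $E(G)\subseteq V(G)\times V(G)$. A tournament is a digraph obtained by choosing exactly one orientation for each edge of an (undirected, loopless) complete graph. For $v\in V(G)$ put $\overrightarrow{N}_G(v)=\{w:(v,w)\in E(G)\}$. The out-neighborhood complex $\overrightarrow{\mathcal{N}}(G)$ is the simplicial complex on vertex set $\{v\in V(G):\mathrm{indeg}(v)>0\}$ generated by the sets $\overrightarrow{N}_G(v)$, $v\in V(G)$ (a nonempty set of vertices is a face iff it is contained in some $\overrightarrow{N}_G(v)$). If $\tau\subsetneq\sigma$ are faces of a simplicial complex $X$ and $\sigma$ is the only facet of $X$ containing $\tau$, then removing all simplices $\gamma$ with $\tau\subseteq\gamma\subseteq\sigma$ is a simplicial collapse; $X$ collapses onto a subcomplex $Y$ if $Y$ is obtained from $X$ by a sequence of simplicial collapses. *)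

theory Defs
  imports "Graph_Theory.Pair_Digraph" "HOL-Analysis.Analysis"
begin

section \<open>Tournaments\<close>

text \<open>
  The locale \<^locale>\<open>pair_digraph\<close> already says that the digraph is finite, loopless and has
  its arcs between vertices.
\<close>

definition tournament :: "'a pair_pre_digraph \<Rightarrow> bool" where
  "tournament G \<longleftrightarrow> pair_digraph G \<and>
     (\<forall>u\<in>pverts G. \<forall>v\<in>pverts G. u \<noteq> v \<longrightarrow> ((u, v) \<in> parcs G \<longleftrightarrow> (v, u) \<notin> parcs G))"

definition out_neighborhood :: "'a pair_pre_digraph \<Rightarrow> 'a \<Rightarrow> 'a set" where
  "out_neighborhood G v = {w. (v, w) \<in> parcs G}"


section \<open>Finite abstract simplicial complexes\<close>

text \<open>
  A complex is given by its set of faces. The empty set is never a face. The vertices are the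
  points whose singletons are faces, so the vertex set is the union of the faces.
\<close>

definition abstract_complex :: "'a set set \<Rightarrow> bool" where
  "abstract_complex K \<longleftrightarrow> finite K \<and>
     (\<forall>\<sigma>\<in>K. finite \<sigma> \<and> \<sigma> \<noteq> {} \<and> (\<forall>\<tau>. \<tau> \<noteq> {} \<and> \<tau> \<subseteq> \<sigma> \<longrightarrow> \<tau> \<in> K))"

definition out_neighborhood_complex :: "'a pair_pre_digraph \<Rightarrow> 'a set set" where
  "out_neighborhood_complex G =
     {\<sigma>. \<sigma> \<noteq> {} \<and> \<sigma> \<subseteq> {v \<in> pverts G. in_degree (with_proj G) v > 0} \<and>
         (\<exists>v\<in>pverts G. \<sigma> \<subseteq> out_neighborhood G v)}"

definition simplex_boundary :: "'a set \<Rightarrow> 'a set set" where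
  "simplex_boundary S = {\<tau>. \<tau> \<noteq> {} \<and> \<tau> \<subset> S}"

definition facet :: "'a set set \<Rightarrow> 'a set \<Rightarrow> bool" where
  "facet K \<sigma> \<longleftrightarrow> \<sigma> \<in> K \<and> (\<forall>\<rho>\<in>K. \<sigma> \<subseteq> \<rho> \<longrightarrow> \<rho> = \<sigma>)"

definition simplicial_collapse :: "'a set set \<Rightarrow> 'a set set \<Rightarrow> bool" where
  "simplicial_collapse K L \<longleftrightarrow>
     (\<exists>\<tau>\<in>K. \<exists>\<sigma>\<in>K. \<tau> \<subset> \<sigma> \<and> (\<forall>\<rho>. facet K \<rho> \<and> \<tau> \<subseteq> \<rho> \<longleftrightarrow> \<rho> = \<sigma>) \<and>
        L = K - {\<gamma>. \<tau> \<subseteq> \<gamma> \<and> \<gamma> \<subseteq> \<sigma>})"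

definition collapses_onto :: "'a set set \<Rightarrow> 'a set set \<Rightarrow> bool" where
  "collapses_onto K L \<longleftrightarrow> simplicial_collapse\<^sup>*\<^sup>* K L"

text \<open>
  Points of the realization are given by their barycentric coordinates, extended by zero. On a
  finite complex the product topology induces the usual topology.
\<close>

definition geometric_realization :: "'a set set \<Rightarrow> ('a \<Rightarrow> real) topology" where
  "geometric_realization K =
     subtopology (powertop_real UNIV)
       {x. (\<forall>v. 0 \<le> x v) \<and> {v. x v \<noteq> 0} \<in> K \<and> (\<Sum>v | x v \<noteq> 0. x v) = 1}"


section \<open>Well-formedness of these notions\<close>

lemma abstract_complexI:
  assumes "finite V" "K \<subseteq> Pow V" "{} \<notin> K"
    and "\<And>\<sigma> \<tau>. \<sigma> \<in> K \<Longrightarrow> \<tau> \<noteq> {} \<Longrightarrow> \<tau> \<subseteq> \<sigma> \<Longrightarrow> \<tau> \<in> K"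
  shows "abstract_complex K"
  unfolding abstract_complex_def
proof (intro conjI ballI allI impI)
  show "finite K"
    using assms(1,2) by (meson finite_Pow_iff finite_subset)
  show "finite \<sigma>" if "\<sigma> \<in> K" for \<sigma>
    using assms(1,2) that by (meson PowD finite_subset subsetD)
  show "\<sigma> \<noteq> {}" if "\<sigma> \<in> K" for \<sigma>
    using assms(3) that by metis
  show "\<tau> \<in> K" if "\<sigma> \<in> K" "\<tau> \<noteq> {} \<and> \<tau> \<subseteq> \<sigma>" for \<sigma> \<tau>
    using assms(4) that by metis
qed

lemma abstract_complex_out_neighborhood_complex:
  assumes "finite (pverts G)"
  shows "abstract_complex (out_neighborhood_complex G)"
proof (rule abstract_complexI[OF assms])
  show "out_neighborhood_complex G \<subseteq> Pow (pverts G)" "{} \<notin> out_neighborhood_complex G"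
    by (auto simp: out_neighborhood_complex_def)
next
  fix \<sigma> \<tau> :: "'a set"
  assume \<sigma>: "\<sigma> \<in> out_neighborhood_complex G" and \<tau>: "\<tau> \<noteq> {}" "\<tau> \<subseteq> \<sigma>"
  from \<sigma> obtain v where "v \<in> pverts G" "\<sigma> \<subseteq> out_neighborhood G v"
    and "\<sigma> \<subseteq> {v \<in> pverts G. in_degree (with_proj G) v > 0}"
    unfolding out_neighborhood_complex_def mem_Collect_eq by (elim conjE bexE)
  then show "\<tau> \<in> out_neighborhood_complex G"
    unfolding out_neighborhood_complex_def mem_Collect_eq
    using \<tau> by (meson subset_trans)
qed

lemma vertices_out_neighborhood_complex:
  assumes "pair_digraph G"
  shows "\<Union> (out_neighborhood_complex G) = {v \<in> pverts G. in_degree (with_proj G) v > 0}"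
proof
  show "\<Union> (out_neighborhood_complex G) \<subseteq> {v \<in> pverts G. in_degree (with_proj G) v > 0}"
    by (auto simp: out_neighborhood_complex_def)
next
  interpret pair_digraph G by fact
  show "{v \<in> pverts G. in_degree (with_proj G) v > 0} \<subseteq> \<Union> (out_neighborhood_complex G)"
  proof
    fix v assume v: "v \<in> {v \<in> pverts G. in_degree (with_proj G) v > 0}"
    then have "in_arcs (with_proj G) v \<noteq> {}"
      by (auto simp: in_degree_def card_gt_0_iff)
    then obtain u where u: "(u, v) \<in> parcs G"
      by (auto simp: in_arcs_def)
    then have "{v} \<in> out_neighborhood_complex G"
      using v in_arcsD1[OF u] by (auto simp: out_neighborhood_complex_def out_neighborhood_def)
    then show "v \<in> \<Union> (out_neighborhood_complex G)" by blast
  qed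
qed

lemma abstract_complex_simplex_boundary:
  assumes "finite S"
  shows "abstract_complex (simplex_boundary S)"
  by (rule abstract_complexI[OF assms]) (auto simp: simplex_boundary_def)

lemma ex_facet_supset:
  assumes "finite K" "\<gamma> \<in> K"
  shows "\<exists>\<rho>. facet K \<rho> \<and> \<gamma> \<subseteq> \<rho>"
  using finite_has_maximal2[OF assms] by (auto simp: facet_def)

lemma simplicial_collapse_subcomplex:
  assumes "simplicial_collapse K L" "abstract_complex K"
  shows "abstract_complex L \<and> L \<subseteq> K"
proof -
  from assms(1) obtain \<tau> \<sigma> where *: "\<forall>\<rho>. facet K \<rho> \<and> \<tau> \<subseteq> \<rho> \<longleftrightarrow> \<rho> = \<sigma>"
    and L: "L = K - {\<gamma>. \<tau> \<subseteq> \<gamma> \<and> \<gamma> \<subseteq> \<sigma>}"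
    unfolding simplicial_collapse_def by (elim bexE conjE)
  have "finite K"
    using assms(2) unfolding abstract_complex_def by (rule conjunct1)
  then have "\<gamma> \<subseteq> \<sigma>" if "\<gamma> \<in> K" "\<tau> \<subseteq> \<gamma>" for \<gamma>
    using ex_facet_supset[of K \<gamma>] that * by (metis subset_trans)
  then have "L = {\<gamma>\<in>K. \<not> \<tau> \<subseteq> \<gamma>}"
    unfolding L by auto
  then show ?thesis
    using assms(2) unfolding abstract_complex_def by auto
qed

lemma collapses_onto_subcomplex:
  assumes "collapses_onto K L" "abstract_complex K"
  shows "abstract_complex L \<and> L \<subseteq> K"
  using assms(1)[unfolded collapses_onto_def]
proof (induction rule: rtranclp_induct)
  case base
  then show ?case using assms(2) by simp
next
  case (step L M)
  then show ?case using simplicial_collapse_subcomplex by (metis subset_trans)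
qed

end

theory Submission
  imports Defs
begin

text \<open>
  The vertices are split into a core \<open>s\<^sub>0, \<dots>, s\<^sub>n\<^sub>+\<^sub>1\<close> and a rim \<open>v\<^sub>1, \<dots>, v\<^sub>n\<^sub>+\<^sub>1\<close>. The core vertex
  \<open>s\<^sub>0\<close> beats the rest of the core, and \<open>v\<^sub>i\<close> beats all of the core except \<open>s\<^sub>i\<close>, so every proper
  face of the core simplex lies in some out-neighborhood. No out-neighborhood contains the whole
  core, since neither \<open>s\<^sub>i\<close> nor \<open>v\<^sub>i\<close> beats \<open>s\<^sub>i\<close>. Hence the complex induced on the core is the boundary of
  an \<open>(n + 1)\<close>-simplex, and it remains to get rid of the rim.

  For this the core and the rim are each oriented from smaller to larger indices. The only
  vertex that beats \<open>v\<^sub>1\<close> is \<open>s\<^sub>1\<close>, which also beats \<open>s\<^sub>n\<^sub>+\<^sub>1\<close>; so the link of \<open>v\<^sub>1\<close> is a cone with apex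
  \<open>s\<^sub>n\<^sub>+\<^sub>1\<close>. A face that contains \<open>v\<^sub>k\<close> with \<open>k \<ge> 2\<close> lies in the out-neighborhood of some \<open>v\<^sub>i\<close> with
  \<open>i < k\<close>, because \<open>s\<^sub>k\<close> beats only \<open>v\<^sub>k\<close> and core vertices of larger index, all of which \<open>v\<^sub>1\<close> beats
  too. As every \<open>v\<^sub>i\<close> beats \<open>s\<^sub>0\<close>, such a face can be extended by \<open>s\<^sub>0\<close>.

  So the rim is removed in two rounds, each for a set \<open>W\<close> of vertices with a common apex \<open>a\<close>
  outside \<open>W\<close>: adding \<open>a\<close> to a face that meets \<open>W\<close> yields a face. Combinatorially, all faces
  that meet \<open>W\<close> can be collapsed away in pairs \<open>\<gamma>\<close>, \<open>insert a \<gamma>\<close>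
  (\<open>collapses_onto_faces_avoiding\<close>). Topologically, sliding the barycentric mass on \<open>W\<close> to \<open>a\<close>
  along straight lines is a deformation retraction (\<open>homotopy_equivalent_faces_avoiding\<close>).
  Finally, the realization of the boundary of a simplex is homeomorphic to a sphere by an
  explicit formula (\<open>realization_simplex_boundary_homeomorphic_nsphere\<close>).
\<close>

section \<open>Collapsing vertices that are dominated by a cone point\<close>

text \<open>
  The faces to be removed come in pairs \<open>\<gamma>\<close>, \<open>insert a \<gamma>\<close> with \<open>a \<notin> \<gamma>\<close>. If \<open>\<gamma>\<close> is maximal among
  the faces that meet \<open>W\<close> and miss \<open>a\<close>, then \<open>insert a \<gamma>\<close> is the only face properly containing \<open>\<gamma>\<close>, so
  the pair is an elementary collapse. Removing a whole pair preserves the cone condition, which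
  allows induction on the number of faces.
\<close>

lemma collapses_onto_faces_avoiding:
  assumes "abstract_complex K" "a \<notin> W"
    and "\<And>\<sigma>. \<sigma> \<in> K \<Longrightarrow> \<sigma> \<inter> W \<noteq> {} \<Longrightarrow> insert a \<sigma> \<in> K"
  shows "collapses_onto K {\<sigma>\<in>K. \<sigma> \<inter> W = {}}"
  using assms
proof (induction "card K" arbitrary: K rule: less_induct)
  case less
  note K = less.prems(1) and aW = less.prems(2) and cone = less.prems(3)
  have finK: "finite K"
    using K by (simp add: abstract_complex_def)
  show ?case
  proof (cases "\<exists>\<sigma>\<in>K. \<sigma> \<inter> W \<noteq> {}")
    case False
    then have "{\<sigma>\<in>K. \<sigma> \<inter> W = {}} = K" by blast
    then show ?thesis by (simp add: collapses_onto_def)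
  next
    case True
    define B where "B = {\<sigma>\<in>K. \<sigma> \<inter> W \<noteq> {} \<and> a \<notin> \<sigma>}"
    obtain \<sigma> where \<sigma>: "\<sigma> \<in> K" "\<sigma> \<inter> W \<noteq> {}"
      using True by blast
    have "\<sigma> - {a} \<noteq> {}"
      using \<sigma> aW by auto
    then have "\<sigma> - {a} \<in> K"
      using K \<sigma>(1) unfolding abstract_complex_def by (meson Diff_subset)
    then have "\<sigma> - {a} \<in> B"
      using \<sigma> aW by (auto simp: B_def)
    moreover have finB: "finite B"
      using finK by (simp add: B_def)
    ultimately obtain \<gamma> where \<gamma>: "\<gamma> \<in> B" and max: "\<And>\<rho>. \<rho> \<in> B \<Longrightarrow> \<gamma> \<subseteq> \<rho> \<Longrightarrow> \<rho> = \<gamma>"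
      using finite_has_maximal[of B] finB by blast
    have \<gamma>': "\<gamma> \<in> K" "\<gamma> \<inter> W \<noteq> {}" "a \<notin> \<gamma>"
      using \<gamma> by (auto simp: B_def)
    let ?\<sigma> = "insert a \<gamma>"
    have \<sigma>K: "?\<sigma> \<in> K"
      using cone \<gamma>' by blast
    have above: "\<rho> \<subseteq> ?\<sigma>" if "\<rho> \<in> K" "\<gamma> \<subseteq> \<rho>" for \<rho>
    proof -
      have "\<rho> - {a} \<noteq> {}"
        using \<gamma>' that(2) by auto
      then have "\<rho> - {a} \<in> K"
        using K that(1) unfolding abstract_complex_def by (meson Diff_subset)
      then have "\<rho> - {a} \<in> B"
        using \<gamma>' that(2) aW by (auto simp: B_def)
      then show ?thesis
        using max[of "\<rho> - {a}"] \<gamma>'(3) that(2) by blast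
    qed
    let ?L = "K - {\<delta>. \<gamma> \<subseteq> \<delta> \<and> \<delta> \<subseteq> ?\<sigma>}"
    have "\<forall>\<rho>. facet K \<rho> \<and> \<gamma> \<subseteq> \<rho> \<longleftrightarrow> \<rho> = ?\<sigma>"
    proof (intro allI iffI)
      fix \<rho> assume "facet K \<rho> \<and> \<gamma> \<subseteq> \<rho>"
      then show "\<rho> = ?\<sigma>"
        using above[of \<rho>] \<sigma>K unfolding facet_def by blast
    next
      fix \<rho> assume \<rho>: "\<rho> = ?\<sigma>"
      show "facet K \<rho> \<and> \<gamma> \<subseteq> \<rho>"
        unfolding facet_def \<rho> using \<sigma>K above by blast
    qed
    moreover have "\<gamma> \<subset> ?\<sigma>"
      using \<gamma>' by blast
    ultimately have step: "simplicial_collapse K ?L"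
      unfolding simplicial_collapse_def using \<gamma>'(1) \<sigma>K by blast
    have "collapses_onto ?L {\<sigma>\<in>?L. \<sigma> \<inter> W = {}}"
    proof (rule less.hyps)
      have "?L \<subset> K" using \<gamma>' by blast
      then show "card ?L < card K"
        using finK by (rule psubset_card_mono[rotated])
      show "abstract_complex ?L"
        using simplicial_collapse_subcomplex[OF step K] by blast
      show "insert a \<delta> \<in> ?L" if "\<delta> \<in> ?L" "\<delta> \<inter> W \<noteq> {}" for \<delta>
        using that cone[of \<delta>] \<gamma>'(3) by blast
    qed fact
    moreover have "{\<sigma>\<in>?L. \<sigma> \<inter> W = {}} = {\<sigma>\<in>K. \<sigma> \<inter> W = {}}"
      using \<gamma>'(2) by blast
    ultimately have "collapses_onto ?L {\<sigma>\<in>K. \<sigma> \<inter> W = {}}"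
      by (simp only:)
    with step show ?thesis
      unfolding collapses_onto_def by (rule converse_rtranclp_into_rtranclp)
  qed
qed

section \<open>Geometric realizations\<close>

definition realization_points :: "'a set set \<Rightarrow> ('a \<Rightarrow> real) set" where
  "realization_points K = {x. (\<forall>v. 0 \<le> x v) \<and> {v. x v \<noteq> 0} \<in> K \<and> (\<Sum>v | x v \<noteq> 0. x v) = 1}"

lemma geometric_realization_eq_top_of_set:
  "geometric_realization K = top_of_set (realization_points K)"
  by (simp add: geometric_realization_def realization_points_def euclidean_product_topology)

text \<open>
  The support varies with the point; with a fixed index set the total masses of different points
  can be compared term by term.
\<close>

lemma mem_realization_points_iff:
  assumes "finite V" "\<Union>K \<subseteq> V"
  shows "x \<in> realization_points K \<longleftrightarrow>
           (\<forall>v. 0 \<le> x v) \<and> {v. x v \<noteq> 0} \<in> K \<and> (\<Sum>v\<in>V. x v) = 1"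
proof -
  have "(\<Sum>v | x v \<noteq> 0. x v) = (\<Sum>v\<in>V. x v)" if "{v. x v \<noteq> 0} \<in> K"
    using that assms by (intro sum.mono_neutral_left) auto
  then show ?thesis
    by (auto simp: realization_points_def)
qed

definition slide_mass :: "'a set \<Rightarrow> 'a \<Rightarrow> real \<Rightarrow> ('a \<Rightarrow> real) \<Rightarrow> 'a \<Rightarrow> real" where
  "slide_mass W a t x v =
     (if v \<in> W then (1 - t) * x v else if v = a then x a + t * (\<Sum>w\<in>W. x w) else x v)"

lemma continuous_on_slide_mass:
  "continuous_on A (\<lambda>(t, x). slide_mass W a t x)"
proof -
  have c: "continuous_on A (\<lambda>z. snd z v)" for v and A :: "(real \<times> ('a \<Rightarrow> real)) set"
    by (rule continuous_on_product_then_coordinatewise) (intro continuous_intros)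
  show ?thesis
    unfolding case_prod_unfold
  proof (rule continuous_on_coordinatewise_then_product)
    fix v
    show "continuous_on A (\<lambda>z. slide_mass W a (fst z) (snd z) v)"
      unfolding slide_mass_def
      by (cases "v \<in> W"; cases "v = a") (auto intro!: continuous_intros c)
  qed
qed

lemma slide_mass_avoiding:
  assumes "\<And>w. w \<in> W \<Longrightarrow> x w = 0"
  shows "slide_mass W a t x = x"
  using assms by (auto simp: slide_mass_def fun_eq_iff)

lemma sum_slide_mass:
  assumes "finite V" "W \<subseteq> V" "a \<in> V" "a \<notin> W"
  shows "(\<Sum>v\<in>V. slide_mass W a t x v) = (\<Sum>v\<in>V. x v)"
proof -
  have "slide_mass W a t x v =
          x v - (if v \<in> W then t * x v else 0) + (if v = a then t * (\<Sum>w\<in>W. x w) else 0)" for v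
    using assms(4) by (auto simp: slide_mass_def algebra_simps)
  then have "(\<Sum>v\<in>V. slide_mass W a t x v) =
      (\<Sum>v\<in>V. x v) - (\<Sum>v\<in>V. if v \<in> W then t * x v else 0) + t * (\<Sum>w\<in>W. x w)"
    using assms(1,3) by (simp add: sum.distrib sum_subtractf)
  also have "(\<Sum>v\<in>V. if v \<in> W then t * x v else 0) = t * (\<Sum>w\<in>W. x w)"
    using assms(1,2) by (simp add: sum.inter_restrict[symmetric] sum_distrib_left Int_absorb1)
  finally show ?thesis by simp
qed

text \<open>
  If the support \<open>\<sigma>\<close> of a point meets \<open>W\<close>, the sliding stays inside the closed simplex
  \<open>insert a \<sigma>\<close>, which is a face by the cone condition; otherwise the point does not move.
\<close>

lemma slide_mass_in_realization_points:
  assumes K: "abstract_complex K" and W: "finite W" "a \<notin> W"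
    and cone: "\<And>\<sigma>. \<sigma> \<in> K \<Longrightarrow> \<sigma> \<inter> W \<noteq> {} \<Longrightarrow> insert a \<sigma> \<in> K"
    and t: "0 \<le> t" "t \<le> 1" and x: "x \<in> realization_points K"
  shows "slide_mass W a t x \<in> realization_points K"
proof (cases "{v. x v \<noteq> 0} \<inter> W = {}")
  case True
  then have "slide_mass W a t x = x"
    by (intro slide_mass_avoiding) blast
  then show ?thesis using x by simp
next
  case False
  define V where "V = \<Union>K \<union> W \<union> {a}"
  have V: "finite V" "\<Union>K \<subseteq> V" "W \<subseteq> V" "a \<in> V"
    using K W(1) by (auto simp: V_def abstract_complex_def)
  note mem = mem_realization_points_iff[OF V(1,2)]
  have x0: "\<And>v. 0 \<le> x v" and xK: "{v. x v \<noteq> 0} \<in> K" and x1: "sum x V = 1"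
    using x by (auto simp: mem)
  let ?y = "slide_mass W a t x"
  have sum: "sum ?y V = 1"
    using sum_slide_mass[OF V(1,3,4) W(2)] x1 by simp
  have "{v. ?y v \<noteq> 0} \<noteq> {}"
    using sum by (metis (mono_tags, lifting) empty_Collect_eq sum.neutral zero_neq_one)
  moreover have "{v. ?y v \<noteq> 0} \<subseteq> insert a {v. x v \<noteq> 0}"
    by (auto simp: slide_mass_def)
  moreover have "insert a {v. x v \<noteq> 0} \<in> K"
    using cone xK False by blast
  ultimately have "{v. ?y v \<noteq> 0} \<in> K"
    using K unfolding abstract_complex_def by meson
  moreover have "0 \<le> ?y v" for v
    using t x0 by (simp add: slide_mass_def sum_nonneg)
  ultimately show ?thesis
    using sum by (simp add: mem)
qed

text \<open>
  Sliding is a strong deformation retraction: it fixes the points supported off \<open>W\<close>, and at time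
  \<open>1\<close> no mass is left on \<open>W\<close>.
\<close>

lemma homotopy_equivalent_faces_avoiding:
  assumes K: "abstract_complex K" and W: "finite W" "a \<notin> W"
    and cone: "\<And>\<sigma>. \<sigma> \<in> K \<Longrightarrow> \<sigma> \<inter> W \<noteq> {} \<Longrightarrow> insert a \<sigma> \<in> K"
  shows "geometric_realization K homotopy_equivalent_space
           geometric_realization {\<sigma>\<in>K. \<sigma> \<inter> W = {}}"
proof -
  let ?P = "realization_points K" and ?Q = "realization_points {\<sigma>\<in>K. \<sigma> \<inter> W = {}}"
  let ?h = "slide_mass W a"
  note inP = slide_mass_in_realization_points[OF K W cone]
  have Q: "?Q = {x\<in>?P. \<forall>w\<in>W. x w = 0}"
    by (auto simp: realization_points_def)
  have h0: "?h 0 x = x" for x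
    by (auto simp: slide_mass_def fun_eq_iff)
  have cont: "continuous_on ?P (?h 1)"
  proof -
    have "continuous_on ?P ((\<lambda>(t, x). ?h t x) \<circ> (\<lambda>x. (1, x)))"
      by (intro continuous_on_compose continuous_intros continuous_on_slide_mass)
    then show ?thesis by (simp add: o_def)
  qed
  have "homotopic_with (\<lambda>x. True) (top_of_set ?P) (top_of_set ?P) id (?h 1)"
    unfolding homotopic_with_def
  proof (intro exI conjI)
    show "continuous_map (prod_topology (top_of_set {0..1}) (top_of_set ?P)) (top_of_set ?P)
            (\<lambda>(t, x). ?h t x)"
      using inP continuous_on_slide_mass by auto
  qed (auto simp: h0)
  then have "homotopic_with (\<lambda>x. True) (top_of_set ?P) (top_of_set ?P) (?h 1) id"
    by (rule homotopic_with_symD)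
  moreover have "retraction_maps (top_of_set ?P) (top_of_set ?Q) (?h 1) id"
  proof -
    have "?h 1 x \<in> ?Q" if "x \<in> ?P" for x
      using inP[of 1 x] that by (simp add: Q) (simp add: slide_mass_def)
    moreover have "?h 1 x = x" if "x \<in> ?Q" for x
      using that by (intro slide_mass_avoiding) (simp add: Q)
    ultimately show ?thesis
      using cont unfolding retraction_maps_def by (auto simp: Q)
  qed
  ultimately show ?thesis
    unfolding geometric_realization_eq_top_of_set
    by (rule deformation_retract_imp_homotopy_equivalent_space)
qed

section \<open>The boundary of a simplex is a sphere\<close>

lemma realization_points_simplex_boundary:
  "realization_points (simplex_boundary {..Suc n}) =
     {x. (\<forall>i. 0 \<le> x i) \<and> (\<forall>i>Suc n. x i = 0) \<and> (\<exists>i\<le>Suc n. x i = 0) \<and> (\<Sum>i\<le>Suc n. x i) = 1}"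
    (is "?L = ?R")
proof -
  have "x \<in> ?L \<longleftrightarrow> x \<in> ?R" for x
  proof -
    have "{v. x v \<noteq> 0} \<subseteq> {..Suc n} \<longleftrightarrow> (\<forall>i>Suc n. x i = 0)"
      by (metis (mono_tags, lifting) atMost_iff mem_Collect_eq not_le subset_iff)
    moreover have "{v. x v \<noteq> 0} \<noteq> {..Suc n} \<longleftrightarrow> (\<exists>i\<le>Suc n. x i = 0)"
      if "{v. x v \<noteq> 0} \<subseteq> {..Suc n}"
      using that by blast
    ultimately have "{v. x v \<noteq> 0} \<in> simplex_boundary {..Suc n} \<longleftrightarrow>
        (\<exists>i. x i \<noteq> 0) \<and> (\<forall>i>Suc n. x i = 0) \<and> (\<exists>i\<le>Suc n. x i = 0)"
      unfolding simplex_boundary_def psubset_eq by blast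
    moreover have "\<exists>i. x i \<noteq> 0" if "(\<Sum>i\<le>Suc n. x i) = 1"
      using that by (metis sum.neutral zero_neq_one)
    moreover have "\<Union>(simplex_boundary {..Suc n}) \<subseteq> {..Suc n}"
      by (auto simp: simplex_boundary_def)
    ultimately show ?thesis
      using mem_realization_points_iff[of "{..Suc n}" "simplex_boundary {..Suc n}" x] by auto
  qed
  then show ?thesis by blast
qed

lemma continuous_on_Min_coordinates:
  assumes "finite I" "I \<noteq> {}"
  shows "continuous_on A (\<lambda>x :: 'a \<Rightarrow> real. Min (x ` I))"
  using assms
proof (induction rule: finite_ne_induct)
  case (singleton i)
  then show ?case
    by (auto intro: continuous_on_subset[OF continuous_on_product_coordinates])
next
  case (insert i I)
  have "continuous_on A (\<lambda>x :: 'a \<Rightarrow> real. min (x i) (Min (x ` I)))"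
    using insert.IH
    by (intro continuous_on_min) (auto intro: continuous_on_subset[OF continuous_on_product_coordinates])
  then show ?case
    using insert.hyps by simp
qed

text \<open>
  The points with minimal coordinate \<open>0\<close> form a section of the quotient of \<open>\<real>\<^sup>n\<^sup>+\<^sup>2\<close> by the
  diagonal: subtracting the minimum picks the representative. Subtracting the last coordinate
  picks the representative in \<open>\<real>\<^sup>n\<^sup>+\<^sup>1\<close>. Both bijections commute with positive scaling, so they
  identify the rays of the two cones; the boundary of the simplex meets each nonzero ray of the
  first cone once (mass \<open>1\<close>), and the sphere each ray of the second (norm \<open>1\<close>).
\<close>

lemma realization_simplex_boundary_homeomorphic_nsphere:
  "geometric_realization (simplex_boundary {..Suc n}) homeomorphic_space nsphere n"
proof -
  let ?P = "realization_points (simplex_boundary {..Suc n})"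
  let ?S = "{y :: nat \<Rightarrow> real. (\<Sum>i\<le>n. y i ^ 2) = 1 \<and> (\<forall>i>n. y i = 0)}"
  \<comment> \<open>\<open>N\<close> and \<open>s\<close> are the norm and the mass by which the two representatives are rescaled.\<close>
  define N where "N x = sqrt (\<Sum>i\<le>n. (x i - x (Suc n)) ^ 2)" for x :: "nat \<Rightarrow> real"
  define f where "f x i = (if i \<le> n then (x i - x (Suc n)) / N x else 0)" for x i
  \<comment> \<open>The coordinate \<open>Suc n\<close>, where points of the sphere vanish, takes part in the minimum.\<close>
  define m where "m y = Min (y ` {..Suc n})" for y :: "nat \<Rightarrow> real"
  define s where "s y = (\<Sum>i\<le>Suc n. y i - m y)" for y :: "nat \<Rightarrow> real"
  define g where "g y i = (if i \<le> Suc n then (y i - m y) / s y else 0)" for y i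
  note P = realization_points_simplex_boundary[of n]
  have coord: "continuous_on A (\<lambda>x. x i)" for A and i :: nat
    by (rule continuous_on_subset[OF continuous_on_product_coordinates]) simp

  have m_le: "m y \<le> y i" if "i \<le> Suc n" for y i
    using that by (simp add: m_def)
  have m_att: "\<exists>i\<le>Suc n. y i = m y" for y
  proof -
    have "m y \<in> y ` {..Suc n}"
      unfolding m_def by (rule Min_in) auto
    then show ?thesis by force
  qed
  have m_eq: "m y = c" if "\<And>i. i \<le> Suc n \<Longrightarrow> c \<le> y i" "j \<le> Suc n" "y j = c" for y c j
  proof (rule antisym)
    show "m y \<le> c" using m_le[of j y] that(2,3) by simp
    obtain k where "k \<le> Suc n" "y k = m y" using m_att by blast
    then show "c \<le> m y" using that(1)[of k] by simp
  qed

  have N_pos: "N x > 0" if "x \<in> ?P" for x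
  proof -
    have x: "\<exists>i\<le>Suc n. x i = 0" "sum x {..Suc n} = 1"
      using that by (auto simp: P)
    have "\<exists>i\<le>n. x i \<noteq> x (Suc n)"
    proof (rule ccontr)
      assume "\<not> ?thesis"
      then have c: "x i = x (Suc n)" if "i \<le> Suc n" for i
        using that by (auto simp: le_Suc_eq)
      obtain k where "k \<le> Suc n" "x k = 0" using x(1) by blast
      then have "x i = 0" if "i \<le> Suc n" for i
        using c[OF that] c[of k] by simp
      then show False using x(2) by simp
    qed
    then obtain i where "i \<le> n" "x i \<noteq> x (Suc n)" by blast
    then have "(\<Sum>i\<le>n. (x i - x (Suc n)) ^ 2) > 0"
      by (intro sum_pos2[of _ i]) auto
    then show ?thesis by (simp add: N_def)
  qed
  have s_pos: "s y > 0" if "y \<in> ?S" for y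
  proof -
    have "\<exists>i\<le>n. y i \<noteq> 0"
    proof (rule ccontr)
      assume "\<not> ?thesis"
      then have "(\<Sum>i\<le>n. y i ^ 2) = 0" by (intro sum.neutral) auto
      then show False using that by simp
    qed
    then obtain i where i: "i \<le> n" "y i \<noteq> 0" by blast
    have "y (Suc n) = 0" using that by simp
    then have "y i \<noteq> m y \<or> y (Suc n) \<noteq> m y"
      using i(2) by simp
    then obtain j where j: "j \<le> Suc n" "y j \<noteq> m y"
      using i(1) by (meson le_SucI order_refl)
    then have "y j > m y"
      using m_le[of j y] by simp
    show ?thesis
      unfolding s_def by (rule sum_pos2[of _ j]) (use j(1) \<open>y j > m y\<close> m_le in auto)
  qed

  have fS: "f x \<in> ?S" if "x \<in> ?P" for x
  proof -
    have "(\<Sum>i\<le>n. f x i ^ 2) = (\<Sum>i\<le>n. (x i - x (Suc n)) ^ 2) / N x ^ 2"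
      by (simp add: f_def power_divide sum_divide_distrib)
    also have "\<dots> = 1"
      using N_pos[OF that] by (simp add: N_def)
    finally show ?thesis by (simp add: f_def)
  qed
  have gP: "g y \<in> ?P" if "y \<in> ?S" for y
  proof -
    have "0 \<le> g y i" for i
      using s_pos[OF that] m_le by (simp add: g_def)
    moreover have "\<exists>i\<le>Suc n. g y i = 0"
      using m_att[of y] by (auto simp: g_def)
    moreover have "(\<Sum>i\<le>Suc n. g y i) = (\<Sum>i\<le>Suc n. y i - m y) / s y"
      unfolding sum_divide_distrib by (intro sum.cong) (auto simp: g_def)
    moreover have "(\<Sum>i\<le>Suc n. y i - m y) = s y"
      by (simp only: s_def)
    moreover have "\<forall>i>Suc n. g y i = 0"
      by (simp add: g_def)
    ultimately show ?thesis
      using s_pos[OF that] by (simp add: P del: sum.atMost_Suc)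
  qed
  have gf: "g (f x) = x" if "x \<in> ?P" for x
  proof -
    have x: "\<And>i. 0 \<le> x i" "\<And>i. i > Suc n \<Longrightarrow> x i = 0" "sum x {..Suc n} = 1"
      and x0: "\<exists>i\<le>Suc n. x i = 0"
      using that by (auto simp: P)
    obtain j where j: "j \<le> Suc n" "x j = 0"
      using x0 by blast
    have f: "f x i = (x i - x (Suc n)) / N x" if "i \<le> Suc n" for i
      using that by (auto simp: f_def le_Suc_eq)
    have "m (f x) = - x (Suc n) / N x"
    proof (rule m_eq[OF _ j(1)])
      show "- x (Suc n) / N x \<le> f x i" if "i \<le> Suc n" for i
        unfolding f[OF that] using x(1)[of i] N_pos[OF \<open>x \<in> ?P\<close>] by (intro divide_right_mono) auto
      show "f x j = - x (Suc n) / N x"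
        using f[OF j(1)] j(2) by simp
    qed
    then have d: "f x i - m (f x) = x i / N x" if "i \<le> Suc n" for i
      using f that by (simp add: diff_divide_distrib)
    have "s (f x) = (\<Sum>i\<le>Suc n. x i / N x)"
      unfolding s_def by (intro sum.cong) (auto simp: d)
    also have "\<dots> = 1 / N x"
      using x(3) by (simp add: sum_divide_distrib[symmetric] del: sum.atMost_Suc)
    finally have s: "s (f x) = 1 / N x" .
    have "g (f x) i = x i" for i
    proof (cases "i \<le> Suc n")
      case True
      then show ?thesis
        using d[OF True] s N_pos[OF that] by (simp add: g_def)
    next
      case False
      then show ?thesis
        using x(2)[of i] by (simp add: g_def)
    qed
    then show ?thesis by blast
  qed
  have fg: "f (g y) = y" if "y \<in> ?S" for y
  proof -
    have y: "(\<Sum>i\<le>n. y i ^ 2) = 1" "\<And>i. i > n \<Longrightarrow> y i = 0"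
      using that by auto
    have d: "g y i - g y (Suc n) = y i / s y" if "i \<le> n" for i
      using that y(2)[of "Suc n"] by (simp add: g_def diff_divide_distrib)
    have "(\<Sum>i\<le>n. (g y i - g y (Suc n)) ^ 2) = (\<Sum>i\<le>n. y i ^ 2) / s y ^ 2"
      by (simp add: d power_divide sum_divide_distrib)
    then have "N (g y) = 1 / s y"
      using y(1) s_pos[OF that] by (simp add: N_def real_sqrt_divide)
    then have "f (g y) i = y i" for i
      using d[of i] y(2)[of i] s_pos[OF that] by (simp add: f_def)
    then show ?thesis by blast
  qed
  have cf: "continuous_on ?P f"
  proof (rule continuous_on_coordinatewise_then_product)
    fix i
    have cN: "continuous_on ?P N"
      unfolding N_def by (intro continuous_intros coord)
    have "\<forall>x\<in>?P. N x \<noteq> 0"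
    proof
      show "N x \<noteq> 0" if "x \<in> ?P" for x using N_pos[OF that] by simp
    qed
    then have "continuous_on ?P (\<lambda>x. (x i - x (Suc n)) / N x)"
      by (intro continuous_intros coord cN)
    then show "continuous_on ?P (\<lambda>x. f x i)"
      unfolding f_def by (cases "i \<le> n") auto
  qed
  have cg: "continuous_on ?S g"
  proof (rule continuous_on_coordinatewise_then_product)
    fix i
    have cm: "continuous_on ?S m"
      unfolding m_def by (rule continuous_on_Min_coordinates) auto
    then have cs: "continuous_on ?S s"
      unfolding s_def by (intro continuous_intros coord)
    have "\<forall>y\<in>?S. s y \<noteq> 0"
    proof
      show "s y \<noteq> 0" if "y \<in> ?S" for y using s_pos[OF that] by simp
    qed
    then have "continuous_on ?S (\<lambda>y. (y i - m y) / s y)"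
      by (intro continuous_intros coord cm cs)
    then show "continuous_on ?S (\<lambda>y. g y i)"
      unfolding g_def by (cases "i \<le> Suc n") auto
  qed
  have "homeomorphic_maps (top_of_set ?P) (top_of_set ?S) f g"
    unfolding homeomorphic_maps_def
  proof (intro conjI ballI)
    show "continuous_map (top_of_set ?P) (top_of_set ?S) f"
      unfolding continuous_map_subtopology_eu by (intro conjI cf Pi_I fS)
    show "continuous_map (top_of_set ?S) (top_of_set ?P) g"
      unfolding continuous_map_subtopology_eu by (intro conjI cg Pi_I gP)
    show "g (f x) = x" if "x \<in> topspace (top_of_set ?P)" for x
      by (rule gf) (use that in \<open>simp only: topspace_euclidean_subtopology\<close>)
    show "f (g y) = y" if "y \<in> topspace (top_of_set ?S)" for y
      by (rule fg) (use that in \<open>simp only: topspace_euclidean_subtopology\<close>)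
  qed
  then show ?thesis
    unfolding geometric_realization_eq_top_of_set nsphere euclidean_product_topology
    by (rule homeomorphic_maps_imp_homeomorphic_space)
qed

section \<open>A tournament whose rim collapses onto its core\<close>

text \<open>
  The core vertex \<open>s\<^sub>i\<close> is encoded as \<open>i \<le> n + 1\<close> and the rim vertex \<open>v\<^sub>i\<close> as \<open>i + (n + 1)\<close>, for
  \<open>1 \<le> i \<le> n + 1\<close>. Within the core and within the rim, smaller numbers win; across, \<open>v\<^sub>i\<close> loses
  against \<open>s\<^sub>i\<close> only.
\<close>

definition beats :: "nat \<Rightarrow> nat \<Rightarrow> nat \<Rightarrow> bool" where
  "beats n u v \<longleftrightarrow>
     (if u \<le> n + 1 \<and> v > n + 1 then v = u + (n + 1)
      else if u > n + 1 \<and> v \<le> n + 1 then u \<noteq> v + (n + 1)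
      else u < v)"

lemma beats_irrefl: "\<not> beats n u u"
  by (auto simp: beats_def)

definition sphere_tournament :: "nat \<Rightarrow> nat pair_pre_digraph" where
  "sphere_tournament n =
     \<lparr>pverts = {..<2 * n + 3},
      parcs = {(u, v). u < 2 * n + 3 \<and> v < 2 * n + 3 \<and> beats n u v}\<rparr>"

lemma tournament_sphere_tournament: "tournament (sphere_tournament n)"
  unfolding tournament_def
proof
  have "finite {(u, v). u < 2 * n + 3 \<and> v < 2 * n + 3 \<and> beats n u v}"
    by (rule finite_subset[of _ "{..<2 * n + 3} \<times> {..<2 * n + 3}"]) auto
  then show "pair_digraph (sphere_tournament n)"
    by unfold_locales (auto simp: sphere_tournament_def beats_irrefl)
qed (auto simp: sphere_tournament_def beats_def)

text \<open>
  The head of an arc has positive in-degree, so every out-neighborhood consists of vertices of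
  the complex.
\<close>

lemma out_neighborhood_complex_altdef:
  assumes "pair_digraph G"
  shows "out_neighborhood_complex G =
           {\<sigma>. \<sigma> \<noteq> {} \<and> (\<exists>v\<in>pverts G. \<sigma> \<subseteq> out_neighborhood G v)}"
proof -
  interpret pair_digraph G by fact
  have "out_neighborhood G v \<subseteq> {v \<in> pverts G. in_degree (with_proj G) v > 0}" for v
  proof
    fix w assume "w \<in> out_neighborhood G v"
    then have vw: "(v, w) \<in> parcs G"
      by (simp add: out_neighborhood_def)
    then have "(v, w) \<in> in_arcs (with_proj G) w"
      by (simp add: in_arcs_def)
    then have "in_degree (with_proj G) w > 0"
      unfolding in_degree_def by (metis card_gt_0_iff empty_iff finite_in_arcs)
    then show "w \<in> {v \<in> pverts G. in_degree (with_proj G) v > 0}"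
      using arc_snd_in_verts[OF vw] by simp
  qed
  then show ?thesis
    unfolding out_neighborhood_complex_def by blast
qed

lemma out_neighborhood_sphere_tournament:
  "u < 2 * n + 3 \<Longrightarrow>
     out_neighborhood (sphere_tournament n) u = {v. v < 2 * n + 3 \<and> beats n u v}"
  by (simp add: out_neighborhood_def sphere_tournament_def)

lemma mem_out_neighborhood_complex_sphere_tournament:
  "\<sigma> \<in> out_neighborhood_complex (sphere_tournament n) \<longleftrightarrow>
     \<sigma> \<noteq> {} \<and> (\<exists>u<2 * n + 3. \<sigma> \<subseteq> {v. v < 2 * n + 3 \<and> beats n u v})"
proof -
  have "pair_digraph (sphere_tournament n)"
    using tournament_sphere_tournament by (simp add: tournament_def)
  moreover have "pverts (sphere_tournament n) = {..<2 * n + 3}"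
    by (simp add: sphere_tournament_def)
  ultimately show ?thesis
    using out_neighborhood_sphere_tournament[of _ n]
    by (auto simp: out_neighborhood_complex_altdef)
qed

text \<open>
  The only vertex that beats \<open>v\<^sub>1\<close>, encoded as \<open>n + 2\<close>, is \<open>s\<^sub>1\<close>. For \<open>n = 0\<close> the last core vertex
  would be \<open>s\<^sub>1\<close> itself, which is where \<open>n \<ge> 1\<close> enters.
\<close>

lemma face_insert_last_core_vertex:
  assumes "n \<ge> 1" "\<sigma> \<in> out_neighborhood_complex (sphere_tournament n)" "\<sigma> \<inter> {n + 2} \<noteq> {}"
  shows "insert (n + 1) \<sigma> \<in> out_neighborhood_complex (sphere_tournament n)"
proof -
  obtain u where u: "u < 2 * n + 3" "\<sigma> \<subseteq> {v. v < 2 * n + 3 \<and> beats n u v}"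
    using assms(2) by (auto simp: mem_out_neighborhood_complex_sphere_tournament)
  then have "beats n u (n + 2)"
    using assms(3) by blast
  then have "u = 1"
    by (auto simp: beats_def split: if_splits)
  then have "beats n u (n + 1)"
    using assms(1) by (simp add: beats_def)
  then show ?thesis
    unfolding mem_out_neighborhood_complex_sphere_tournament
    using u by (intro conjI exI[of _ u]) auto
qed

text \<open>
  Rim vertices beat \<open>s\<^sub>0\<close>. A core vertex that beats \<open>v\<^sub>k\<close> with \<open>k \<ge> 2\<close> can only be \<open>s\<^sub>k\<close>, and then its
  out-neighborhood is contained in that of \<open>v\<^sub>1\<close>.
\<close>

lemma face_insert_source:
  assumes "\<sigma> \<in> out_neighborhood_complex (sphere_tournament n)" "\<sigma> \<inter> {n + 3..2 * n + 2} \<noteq> {}"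
  shows "insert 0 \<sigma> \<in> out_neighborhood_complex (sphere_tournament n)"
proof -
  obtain u where u: "u < 2 * n + 3" "\<sigma> \<subseteq> {v. v < 2 * n + 3 \<and> beats n u v}"
    using assms(1) by (auto simp: mem_out_neighborhood_complex_sphere_tournament)
  obtain w where w: "w \<in> \<sigma>" "n + 3 \<le> w" "w \<le> 2 * n + 2"
    using assms(2) by auto
  have uw: "beats n u w"
    using u(2) w(1) by blast
  have "\<exists>u'<2 * n + 3. beats n u' 0 \<and> \<sigma> \<subseteq> {v. v < 2 * n + 3 \<and> beats n u' v}"
  proof (cases "u \<le> n + 1")
    case True
    then have "u \<ge> 2"
      using uw w by (auto simp: beats_def split: if_splits)
    have "beats n (n + 2) v" if "beats n u v" "v < 2 * n + 3" for v
      using that True \<open>u \<ge> 2\<close> by (auto simp: beats_def split: if_splits)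
    then have "\<sigma> \<subseteq> {v. v < 2 * n + 3 \<and> beats n (n + 2) v}"
      using u(2) by blast
    moreover have "beats n (n + 2) 0" "n + 2 < 2 * n + 3"
      using w(2,3) by (auto simp: beats_def)
    ultimately show ?thesis by blast
  next
    case False
    then have "beats n u 0" by (auto simp: beats_def)
    then show ?thesis using u by blast
  qed
  then show ?thesis
    unfolding mem_out_neighborhood_complex_sphere_tournament by auto
qed

lemma faces_within_core_eq_simplex_boundary:
  "{\<sigma> \<in> out_neighborhood_complex (sphere_tournament n).
      \<sigma> \<inter> {n + 2} = {} \<and> \<sigma> \<inter> {n + 3..2 * n + 2} = {}} = simplex_boundary {..n + 1}"
proof (intro set_eqI iffI)
  fix \<sigma>
  assume \<sigma>: "\<sigma> \<in> {\<sigma> \<in> out_neighborhood_complex (sphere_tournament n).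
      \<sigma> \<inter> {n + 2} = {} \<and> \<sigma> \<inter> {n + 3..2 * n + 2} = {}}"
  then obtain u where u: "u < 2 * n + 3" "\<sigma> \<subseteq> {v. v < 2 * n + 3 \<and> beats n u v}" and "\<sigma> \<noteq> {}"
    by (auto simp: mem_out_neighborhood_complex_sphere_tournament)
  have "v \<le> n + 1" if "v \<in> \<sigma>" for v
  proof -
    have "v < 2 * n + 3" "v \<noteq> n + 2" "v \<notin> {n + 3..2 * n + 2}"
      using \<sigma> u that by auto
    then show ?thesis by auto
  qed
  moreover have "\<exists>i\<le>n + 1. i \<notin> \<sigma>"
  proof (cases "u \<le> n + 1")
    case True
    then show ?thesis using u beats_irrefl[of n u] by blast
  next
    case False
    \<comment> \<open>\<open>u\<close> encodes \<open>v\<^sub>i\<close> for \<open>i = u - (n + 1)\<close>.\<close>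
    have "\<not> beats n u (u - (n + 1))"
      using False u(1) by (auto simp: beats_def)
    then show ?thesis
      using u False by (intro exI[of _ "u - (n + 1)"]) auto
  qed
  ultimately show "\<sigma> \<in> simplex_boundary {..n + 1}"
    using \<open>\<sigma> \<noteq> {}\<close> by (auto simp: simplex_boundary_def)
next
  fix \<sigma> assume "\<sigma> \<in> simplex_boundary {..n + 1}"
  then obtain i where \<sigma>: "\<sigma> \<noteq> {}" "\<sigma> \<subseteq> {..n + 1}" and i: "i \<le> n + 1" "i \<notin> \<sigma>"
    unfolding simplex_boundary_def by blast
  \<comment> \<open>The facet opposite to \<open>s\<^sub>i\<close> is covered by \<open>v\<^sub>i\<close>, and the one opposite to \<open>s\<^sub>0\<close> by \<open>s\<^sub>0\<close> itself.\<close>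
  define u where "u = (if i = 0 then 0 else i + (n + 1))"
  have "beats n u v" if "v \<in> \<sigma>" for v
  proof -
    have "v \<le> n + 1" "v \<noteq> i"
      using that \<sigma>(2) i(2) by auto
    then show ?thesis by (auto simp: beats_def u_def)
  qed
  moreover have "v < 2 * n + 3" if "v \<in> \<sigma>" for v
    using that \<sigma>(2) by fastforce
  moreover have "u < 2 * n + 3"
    using i(1) by (simp add: u_def)
  ultimately have "\<sigma> \<in> out_neighborhood_complex (sphere_tournament n)"
    unfolding mem_out_neighborhood_complex_sphere_tournament using \<sigma>(1) by blast
  then show "\<sigma> \<in> {\<sigma> \<in> out_neighborhood_complex (sphere_tournament n).
      \<sigma> \<inter> {n + 2} = {} \<and> \<sigma> \<inter> {n + 3..2 * n + 2} = {}}"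
    using \<sigma>(2) by fastforce
qed

theorem proposition5p1:
  fixes n :: nat
  assumes "n \<ge> 1"
  shows "\<exists>T :: nat pair_pre_digraph.
           tournament T \<and> card (pverts T) = 2 * n + 3 \<and>
           (\<exists>S. card S = n + 2 \<and>
                collapses_onto (out_neighborhood_complex T) (simplex_boundary S)) \<and>
           geometric_realization (out_neighborhood_complex T) homotopy_equivalent_space nsphere n"
proof -
  let ?T = "sphere_tournament n"
  let ?K = "out_neighborhood_complex ?T"
  let ?L = "{\<sigma>\<in>?K. \<sigma> \<inter> {n + 2} = {}}"
  let ?M = "{\<sigma>\<in>?L. \<sigma> \<inter> {n + 3..2 * n + 2} = {}}"
  have K: "abstract_complex ?K"
    by (rule abstract_complex_out_neighborhood_complex) (simp add: sphere_tournament_def)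
  have cone1: "insert (n + 1) \<sigma> \<in> ?K" if "\<sigma> \<in> ?K" "\<sigma> \<inter> {n + 2} \<noteq> {}" for \<sigma>
    using face_insert_last_core_vertex[OF assms that] .
  have cone2: "insert 0 \<sigma> \<in> ?L" if "\<sigma> \<in> ?L" "\<sigma> \<inter> {n + 3..2 * n + 2} \<noteq> {}" for \<sigma>
    using face_insert_source[of \<sigma> n] that by auto
  have M: "?M = simplex_boundary {..n + 1}"
    using faces_within_core_eq_simplex_boundary[of n] by (simp add: conj_assoc)
  have KL: "collapses_onto ?K ?L"
    by (rule collapses_onto_faces_avoiding[OF K _ cone1]) auto
  have L: "abstract_complex ?L"
    using collapses_onto_subcomplex[OF KL K] by blast
  have LM: "collapses_onto ?L ?M"
    by (rule collapses_onto_faces_avoiding[OF L _ cone2]) auto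
  have "geometric_realization ?K homotopy_equivalent_space geometric_realization ?L"
    by (rule homotopy_equivalent_faces_avoiding[OF K _ _ cone1]) auto
  also have "geometric_realization ?L homotopy_equivalent_space geometric_realization ?M"
    by (rule homotopy_equivalent_faces_avoiding[OF L _ _ cone2]) auto
  also have "geometric_realization ?M homotopy_equivalent_space nsphere n"
    unfolding M
    using realization_simplex_boundary_homeomorphic_nsphere[of n]
    by (simp add: homeomorphic_imp_homotopy_equivalent_space)
  finally have "geometric_realization ?K homotopy_equivalent_space nsphere n" .
  moreover have "collapses_onto ?K (simplex_boundary {..n + 1})"
    using KL LM unfolding M collapses_onto_def by (rule rtranclp_trans)
  moreover have "card {..n + 1} = n + 2" by simp
  moreover have "card (pverts ?T) = 2 * n + 3"
    by (simp add: sphere_tournament_def)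
  ultimately show ?thesis
    using tournament_sphere_tournament by blast
qed

end
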